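(* Let $G=(V,E)$ be an infinite, connected, locally finite graph. If $W:V\to\mathbb{R}$ is a potential that is bounded from below and $\omega_0$ is a constant (strictly positive) vertex weight on $V$, then for any conductance $c:E\to\mathbb{R}_+^\star$, the Schrödinger operator $\Delta_{\omega_0,c}+W$, with domain $C_0(V)$, is essentially self-adjoint (as an operator on $l^2_{\omega_0}(V)$).
   Context: $G=(V,E)$ is a graph with vertex set $V$ and edge set $E$, whose edges are unordered pairs $\{x,y\}$ of distinct vertices; $x\sim y$ means $\{x,y\}\in E$. $\mathbb{R}_+^\star=(0,\infty)$. A function $c$ on $E$ is written $c_{x,y}=c_{y,x}$ for $\{x,y\}\in E$. $C_0(V)$ is the space of finitely supported functions $V\to\mathbb{R}$. For a constant $\omega_0>0$, $l^2_{\omega_0}(V)=\{f:V\to\mathbb{R}:\sum_{x\in V}\omega_0^2|f(x)|^2<\infty\}$ is a Hilbert space with scalar product $\langle f,g\rangle=\sum_{x\in V}\omega_0^2f(x)g(x)$. The operator $\Delta_{\omega_0,c}+W$ acts by $$((\Delta_{\omega_0,c}+W)f)(x)=\frac{1}{\omega_0^2}\sum_{y\sim x}c_{x,y}(f(x)-f(y))+W(x)f(x).$$ An unbounded symmetric linear operator on a Hilbert space is essentially self-adjoint if it has a unique self-adjoint extension. *)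

theory Defs
  imports "HOL-Analysis.Analysis" "HOL-Library.Function_Algebras"
begin

instantiation "fun" :: (type, real_vector) real_vector
begin

definition scaleR_fun :: "real \<Rightarrow> ('a \<Rightarrow> 'b) \<Rightarrow> 'a \<Rightarrow> 'b"
  where "scaleR_fun r f = (\<lambda>x. r *\<^sub>R f x)"

instance
  by standard (simp_all add: scaleR_fun_def fun_eq_iff scaleR_add_right scaleR_add_left)

end


section \<open>Unbounded operators\<close>

text \<open>
  The weighted space below depends on a real parameter, so its inner product cannot be a type
  class instance. A real Hilbert space is therefore given by a carrier \<open>H\<close> and an inner
  product \<open>ip\<close> on it. A linear operator is identified with its graph, a single-valued
  subspace of \<open>H \<times> H\<close>; its domain of definition is \<^const>\<open>Domain\<close> of the graph,
  and an extension of it is a superset of the graph.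
\<close>

definition linear_operator :: "'b::real_vector set \<Rightarrow> ('b \<times> 'b) set \<Rightarrow> bool"
  where "linear_operator H T \<longleftrightarrow> T \<subseteq> H \<times> H \<and> subspace T \<and> single_valued T"

definition dense_in ::
  "'b::real_vector set \<Rightarrow> ('b \<Rightarrow> 'b \<Rightarrow> real) \<Rightarrow> 'b set \<Rightarrow> bool"
  where "dense_in H ip D \<longleftrightarrow> D \<subseteq> H \<and> (\<forall>u\<in>H. \<forall>e>0. \<exists>f\<in>D. sqrt (ip (u - f) (u - f)) < e)"

definition symmetric_operator ::
  "'b::real_vector set \<Rightarrow> ('b \<Rightarrow> 'b \<Rightarrow> real) \<Rightarrow> ('b \<times> 'b) set \<Rightarrow> bool"
  where "symmetric_operator H ip T \<longleftrightarrow>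
    linear_operator H T \<and> dense_in H ip (Domain T) \<and>
    (\<forall>(f, Tf)\<in>T. \<forall>(g, Tg)\<in>T. ip Tf g = ip f Tg)"

text \<open>The graph of the adjoint; single-valued if the domain of \<open>T\<close> is dense.\<close>

definition adjoint_operator ::
  "'b::real_vector set \<Rightarrow> ('b \<Rightarrow> 'b \<Rightarrow> real) \<Rightarrow> ('b \<times> 'b) set \<Rightarrow> ('b \<times> 'b) set"
  where "adjoint_operator H ip T = {(u, v) \<in> H \<times> H. \<forall>(f, Tf)\<in>T. ip Tf u = ip f v}"

definition self_adjoint_operator ::
  "'b::real_vector set \<Rightarrow> ('b \<Rightarrow> 'b \<Rightarrow> real) \<Rightarrow> ('b \<times> 'b) set \<Rightarrow> bool"
  where "self_adjoint_operator H ip T \<longleftrightarrow>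
    linear_operator H T \<and> dense_in H ip (Domain T) \<and> adjoint_operator H ip T = T"

definition essentially_self_adjoint ::
  "'b::real_vector set \<Rightarrow> ('b \<Rightarrow> 'b \<Rightarrow> real) \<Rightarrow> ('b \<times> 'b) set \<Rightarrow> bool"
  where "essentially_self_adjoint H ip T \<longleftrightarrow>
    symmetric_operator H ip T \<and> (\<exists>!S. self_adjoint_operator H ip S \<and> T \<subseteq> S)"

definition operator_on :: "'b set \<Rightarrow> ('b \<Rightarrow> 'b) \<Rightarrow> ('b \<times> 'b) set"
  where "operator_on D A = (\<lambda>f. (f, A f)) ` D"


section \<open>Graphs\<close>

definition simple_graph :: "'a set \<Rightarrow> 'a set set \<Rightarrow> bool"
  where "simple_graph V E \<longleftrightarrow> (\<forall>e\<in>E. \<exists>x\<in>V. \<exists>y\<in>V. x \<noteq> y \<and> e = {x, y})"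

definition neighbours :: "'a set set \<Rightarrow> 'a \<Rightarrow> 'a set"
  where "neighbours E x = {y. {x, y} \<in> E}"

definition connected_graph :: "'a set \<Rightarrow> 'a set set \<Rightarrow> bool"
  where "connected_graph V E \<longleftrightarrow> (\<forall>x\<in>V. \<forall>y\<in>V. (x, y) \<in> {(u, v). {u, v} \<in> E}\<^sup>*)"

definition locally_finite_graph :: "'a set \<Rightarrow> 'a set set \<Rightarrow> bool"
  where "locally_finite_graph V E \<longleftrightarrow> (\<forall>x\<in>V. finite (neighbours E x))"


section \<open>Function spaces on the vertices and the operator\<close>

text \<open>Real functions on \<open>V\<close> are represented by functions on the whole type that vanish outside \<open>V\<close>.\<close>

definition functions_on :: "'a set \<Rightarrow> ('a \<Rightarrow> real) set"
  where "functions_on V = {f. \<forall>x. x \<notin> V \<longrightarrow> f x = 0}"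

definition C0 :: "'a set \<Rightarrow> ('a \<Rightarrow> real) set"
  where "C0 V = {f \<in> functions_on V. finite {x \<in> V. f x \<noteq> 0}}"

definition l2 :: "'a set \<Rightarrow> real \<Rightarrow> ('a \<Rightarrow> real) set"
  where "l2 V \<omega>\<^sub>0 = {f \<in> functions_on V. (\<lambda>x. \<omega>\<^sub>0\<^sup>2 * \<bar>f x\<bar>\<^sup>2) summable_on V}"

definition l2_inner :: "'a set \<Rightarrow> real \<Rightarrow> ('a \<Rightarrow> real) \<Rightarrow> ('a \<Rightarrow> real) \<Rightarrow> real"
  where "l2_inner V \<omega>\<^sub>0 f g = (\<Sum>\<^sub>\<infinity>x\<in>V. \<omega>\<^sub>0\<^sup>2 * f x * g x)"

definition schroedinger ::
  "'a set \<Rightarrow> 'a set set \<Rightarrow> real \<Rightarrow> ('a set \<Rightarrow> real) \<Rightarrow> ('a \<Rightarrow> real) \<Rightarrow> ('a \<Rightarrow> real) \<Rightarrow> 'a \<Rightarrow> real"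
  where "schroedinger V E \<omega>\<^sub>0 c W f = (\<lambda>x.
    if x \<in> V then 1 / \<omega>\<^sub>0\<^sup>2 * (\<Sum>y\<in>neighbours E x. c {x, y} * (f x - f y)) + W x * f x
    else 0)"

end

theory Submission
  imports Defs
begin

text \<open>
  Choose \<open>\<mu>\<close> with \<open>W + \<mu> \<ge> 1\<close>. Green's formula shows that the operator plus \<open>\<mu>\<close> is bounded below
  by \<open>1\<close> on finitely supported functions, so it suffices that its adjoint has trivial kernel.
  A function \<open>u\<close> in that kernel solves the equation weakly. Since the vertex weight is constant and
  \<open>u\<close> is square-summable, a positive value of \<open>u\<close> would force a positive maximum of \<open>u\<close>, where the
  equation fails; the same holds for \<open>- u\<close>, hence \<open>u = 0\<close>.
\<close>

section \<open>Real Hilbert spaces on a carrier\<close>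

locale real_hilbert =
  fixes H :: "'b::real_vector set" and ip :: "'b \<Rightarrow> 'b \<Rightarrow> real"
  assumes subspace_carrier: "subspace H"
    and ip_commute: "x \<in> H \<Longrightarrow> y \<in> H \<Longrightarrow> ip x y = ip y x"
    and ip_add_left: "x \<in> H \<Longrightarrow> y \<in> H \<Longrightarrow> z \<in> H \<Longrightarrow> ip (x + y) z = ip x z + ip y z"
    and ip_scaleR_left: "x \<in> H \<Longrightarrow> z \<in> H \<Longrightarrow> ip (r *\<^sub>R x) z = r * ip x z"
    and ip_ge_zero: "x \<in> H \<Longrightarrow> 0 \<le> ip x x"
    and ip_eq_zeroD: "x \<in> H \<Longrightarrow> ip x x = 0 \<Longrightarrow> x = 0"
    and ip_complete: "range X \<subseteq> H \<Longrightarrow>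
      (\<And>e. e > 0 \<Longrightarrow> \<exists>N. \<forall>m\<ge>N. \<forall>n\<ge>N. ip (X m - X n) (X m - X n) < e) \<Longrightarrow>
      \<exists>l\<in>H. (\<lambda>n. ip (X n - l) (X n - l)) \<longlonglongrightarrow> 0"
begin

lemma carrier_closed [simp]:
  "0 \<in> H"
  "x \<in> H \<Longrightarrow> y \<in> H \<Longrightarrow> x + y \<in> H"
  "x \<in> H \<Longrightarrow> y \<in> H \<Longrightarrow> x - y \<in> H"
  "x \<in> H \<Longrightarrow> r *\<^sub>R x \<in> H"
  using subspace_carrier by (auto intro: subspace_0 subspace_add subspace_diff subspace_scale)

lemma ip_diff_left:
  assumes "x \<in> H" "y \<in> H" "z \<in> H"
  shows "ip (x - y) z = ip x z - ip y z"
  using ip_add_left[of "x - y" y z] assms by simp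

lemma ip_add_right: "x \<in> H \<Longrightarrow> y \<in> H \<Longrightarrow> z \<in> H \<Longrightarrow> ip z (x + y) = ip z x + ip z y"
  using ip_add_left[of x y z] by (simp add: ip_commute[of z])

lemma ip_diff_right: "x \<in> H \<Longrightarrow> y \<in> H \<Longrightarrow> z \<in> H \<Longrightarrow> ip z (x - y) = ip z x - ip z y"
  using ip_diff_left[of x y z] by (simp add: ip_commute[of z])

lemma ip_scaleR_right: "x \<in> H \<Longrightarrow> z \<in> H \<Longrightarrow> ip z (r *\<^sub>R x) = r * ip z x"
  using ip_scaleR_left[of x z r] by (simp add: ip_commute[of z])

lemmas ip_simps = ip_add_left ip_add_right ip_diff_left ip_diff_right
  ip_scaleR_left ip_scaleR_right

lemma cauchy_schwarz:
  assumes x: "x \<in> H" and y: "y \<in> H"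
  shows "(ip x y)\<^sup>2 \<le> ip x x * ip y y"
proof (cases "ip y y = 0")
  case True
  then have "y = 0" using ip_eq_zeroD y by blast
  then have "ip x y = 0" using ip_scaleR_right[of x x 0] x by simp
  with True show ?thesis by simp
next
  case False
  then have pos: "ip y y > 0" using ip_ge_zero[OF y] by simp
  have "0 \<le> ip (ip y y *\<^sub>R x - ip x y *\<^sub>R y) (ip y y *\<^sub>R x - ip x y *\<^sub>R y)"
    by (rule ip_ge_zero) (simp add: x y)
  also have "\<dots> = ip y y * (ip x x * ip y y - (ip x y)\<^sup>2)"
    using x y by (simp add: ip_simps ip_commute[of y x] algebra_simps power2_eq_square)
  finally show ?thesis using pos by (simp add: zero_le_mult_iff)
qed

lemma ip_tendsto:
  assumes X: "range X \<subseteq> H" and l: "l \<in> H" and y: "y \<in> H"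
    and lim: "(\<lambda>n. ip (X n - l) (X n - l)) \<longlonglongrightarrow> 0"
  shows "(\<lambda>n. ip (X n) y) \<longlonglongrightarrow> ip l y"
proof -
  have XH: "X n \<in> H" for n using X by auto
  have "(\<lambda>n. ip (X n - l) (X n - l) * ip y y) \<longlonglongrightarrow> 0"
    using tendsto_mult_left_zero[OF lim] by simp
  then have "(\<lambda>n. (ip (X n - l) y)\<^sup>2) \<longlonglongrightarrow> 0"
    by (rule tendsto_sandwich[OF _ _ tendsto_const, rotated 2])
       (auto intro!: always_eventually cauchy_schwarz simp: XH l y)
  then have "(\<lambda>n. ip (X n - l) y) \<longlonglongrightarrow> 0"
    using tendsto_real_sqrt tendsto_rabs_zero_iff by fastforce
  then have "(\<lambda>n. ip (X n) y - ip l y) \<longlonglongrightarrow> 0"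
    by (simp add: ip_diff_left XH l y)
  then show ?thesis by (simp add: LIM_zero_iff)
qed

text \<open>A minimising sequence for the distance to \<open>w\<close> is Cauchy by the parallelogram
  identity, and its limit differs from \<open>w\<close> by a vector orthogonal to \<open>R\<close>.\<close>

lemma trivial_orthogonal_imp_limit:
  assumes R: "subspace R" "R \<subseteq> H"
    and orth: "\<And>u. u \<in> H \<Longrightarrow> (\<And>r. r \<in> R \<Longrightarrow> ip r u = 0) \<Longrightarrow> u = 0"
    and w: "w \<in> H"
  obtains X where "range X \<subseteq> R" "(\<lambda>n. ip (X n - w) (X n - w)) \<longlonglongrightarrow> 0"
proof -
  define d where "d = (INF r\<in>R. ip (w - r) (w - r))"
  have RH: "r \<in> H" if "r \<in> R" for r using R that by auto
  have bdd: "bdd_below ((\<lambda>r. ip (w - r) (w - r)) ` R)"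
    by (rule bdd_belowI2[of _ 0]) (simp add: ip_ge_zero RH w)
  have d_le: "d \<le> ip (w - r) (w - r)" if "r \<in> R" for r
    unfolding d_def by (rule cINF_lower[OF bdd that])
  have "\<exists>r\<in>R. ip (w - r) (w - r) < d + 1 / real (Suc n)" for n
    using cINF_less_iff[OF _ bdd, of "d + 1 / real (Suc n)"] subspace_0[OF R(1)]
    unfolding d_def by auto
  then obtain X where XR: "\<And>n. X n \<in> R"
    and X: "\<And>n. ip (w - X n) (w - X n) < d + 1 / real (Suc n)" by metis
  have XH: "X n \<in> H" for n using XR RH by auto
  have cau: "ip (X m - X n) (X m - X n) \<le> 2 / real (Suc m) + 2 / real (Suc n)" for m n
  proof -
    have mid: "(1/2) *\<^sub>R (X m + X n) \<in> R"
      using R(1) XR by (auto intro: subspace_scale subspace_add)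
    have "ip (X m - X n) (X m - X n) = 2 * ip (w - X m) (w - X m) + 2 * ip (w - X n) (w - X n)
        - 4 * ip (w - (1/2) *\<^sub>R (X m + X n)) (w - (1/2) *\<^sub>R (X m + X n))"
      using w XH by (simp add: ip_simps ip_commute[of w "X m"] ip_commute[of w "X n"]
          ip_commute[of "X n" "X m"] algebra_simps)
    then show ?thesis using X[of m] X[of n] d_le[OF mid] by linarith
  qed
  have "\<exists>N. \<forall>m\<ge>N. \<forall>n\<ge>N. ip (X m - X n) (X m - X n) < e" if e: "e > 0" for e :: real
  proof -
    obtain N where N: "1 / real (Suc N) < e / 4"
      using nat_approx_posE[of "e / 4"] e by auto
    have "ip (X m - X n) (X m - X n) < e" if "m \<ge> N" "n \<ge> N" for m n
    proof -
      have "1 / real (Suc m) \<le> 1 / real (Suc N)" "1 / real (Suc n) \<le> 1 / real (Suc N)"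
        using that by (auto intro!: divide_left_mono)
      then show ?thesis using cau[of m n] N by simp
    qed
    then show ?thesis by blast
  qed
  moreover have rX: "range X \<subseteq> H" using XH by auto
  ultimately obtain h where h: "h \<in> H" and lim: "(\<lambda>n. ip (X n - h) (X n - h)) \<longlonglongrightarrow> 0"
    using ip_complete by blast
  have "ip r (w - h) = 0" if r: "r \<in> R" for r
  proof -
    have rH: "r \<in> H" using RH r .
    have "2 * t * ip (w - h) r \<le> t\<^sup>2 * ip r r" for t
    proof -
      have "2 * t * ip (w - X n) r \<le> 1 / real (Suc n) + t\<^sup>2 * ip r r" for n
      proof -
        have "X n + t *\<^sub>R r \<in> R"
          using R(1) XR r by (auto intro: subspace_scale subspace_add)
        then have "d \<le> ip (w - (X n + t *\<^sub>R r)) (w - (X n + t *\<^sub>R r))" by (rule d_le)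
        also have "\<dots> = ip (w - X n) (w - X n) - 2 * t * ip (w - X n) r + t\<^sup>2 * ip r r"
          using w XH rH by (simp add: ip_simps ip_commute[of w "X n"] ip_commute[of w r] ip_commute[of "X n" r]
              algebra_simps power2_eq_square)
        finally show ?thesis using X[of n] by linarith
      qed
      then have le: "2 * t * (ip w r - ip (X n) r) \<le> 1 / real (Suc n) + t\<^sup>2 * ip r r" for n
        by (simp add: ip_diff_left w XH rH)
      have "(\<lambda>n. 2 * t * (ip w r - ip (X n) r)) \<longlonglongrightarrow> 2 * t * (ip w r - ip h r)"
        by (intro tendsto_intros ip_tendsto rX h rH lim)
      moreover have "(\<lambda>n. 1 / real (Suc n) + t\<^sup>2 * ip r r) \<longlonglongrightarrow> 0 + t\<^sup>2 * ip r r"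
        by (intro tendsto_add LIMSEQ_Suc[OF lim_1_over_n] tendsto_const)
      ultimately have "2 * t * (ip w r - ip h r) \<le> 0 + t\<^sup>2 * ip r r"
        by (rule LIMSEQ_le) (use le in blast)
      then show ?thesis by (simp add: ip_diff_left w h rH)
    qed
    note quad = this
    define a where "a = ip (w - h) r"
    define b where "b = ip r r + 1"
    have b: "b > 0" using ip_ge_zero[OF rH] by (simp add: b_def)
    have "2 * (a / b) * a \<le> (a / b)\<^sup>2 * ip r r"
      using quad[of "a / b"] by (simp add: a_def)
    also have "\<dots> \<le> (a / b)\<^sup>2 * b" by (rule mult_left_mono) (auto simp: b_def)
    also have "\<dots> = a / b * a" using b by (simp add: power2_eq_square)
    finally have "a\<^sup>2 / b \<le> 0" by (simp add: power2_eq_square)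
    then have "a = 0" using b by (simp add: divide_le_0_iff)
    then show ?thesis using ip_commute[of r "w - h"] rH w h by (simp add: a_def)
  qed
  then have "w - h = 0" by (intro orth) (auto simp: w h)
  then have "h = w" by simp
  then show ?thesis using that[of X] XR lim by auto
qed

lemma dense_inI:
  assumes R: "subspace R" "R \<subseteq> H"
    and orth: "\<And>u. u \<in> H \<Longrightarrow> (\<And>r. r \<in> R \<Longrightarrow> ip r u = 0) \<Longrightarrow> u = 0"
  shows "dense_in H ip R"
  unfolding dense_in_def
proof (intro conjI ballI allI impI)
  fix w and e :: real
  assume w: "w \<in> H" and e: "e > 0"
  obtain X where X: "range X \<subseteq> R" and lim: "(\<lambda>n. ip (X n - w) (X n - w)) \<longlonglongrightarrow> 0"
    using trivial_orthogonal_imp_limit[OF R orth w] by blast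
  have "(\<lambda>n. sqrt (ip (X n - w) (X n - w))) \<longlonglongrightarrow> 0"
    using tendsto_real_sqrt[OF lim] by simp
  from order_tendstoD(2)[OF this e] obtain n where n: "sqrt (ip (X n - w) (X n - w)) < e"
    by (auto simp: eventually_sequentially)
  have "X n \<in> H" using X R by auto
  then have "ip (w - X n) (w - X n) = ip (X n - w) (X n - w)"
    using w by (simp add: ip_simps)
  then show "\<exists>f\<in>R. sqrt (ip (w - f) (w - f)) < e" using n X by (intro bexI[of _ "X n"]) auto
qed (use R in auto)

section \<open>A criterion for essential self-adjointness\<close>

lemma adjoint_operator_antimono: "S \<subseteq> T \<Longrightarrow> adjoint_operator H ip T \<subseteq> adjoint_operator H ip S"
  unfolding adjoint_operator_def by blast

lemma adjoint_operator_iff: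
  "(u, v) \<in> adjoint_operator H ip T \<longleftrightarrow>
    u \<in> H \<and> v \<in> H \<and> (\<forall>f g. (f, g) \<in> T \<longrightarrow> ip g u = ip f v)"
  unfolding adjoint_operator_def by auto

lemma subspace_adjoint_operator:
  assumes "T \<subseteq> H \<times> H"
  shows "subspace (adjoint_operator H ip T)"
proof -
  have "ip f 0 = 0" if "f \<in> H" for f
    using ip_scaleR_right[of f f 0] that by simp
  with assms show ?thesis
    unfolding subspace_def
    by (auto simp: adjoint_operator_iff zero_prod_def ip_simps subset_iff)
qed

lemma single_valued_adjoint_operator:
  assumes T: "T \<subseteq> H \<times> H" and dense: "dense_in H ip (Domain T)"
  shows "single_valued (adjoint_operator H ip T)"
proof (rule single_valuedI)
  fix u v v'
  assume 1: "(u, v) \<in> adjoint_operator H ip T" and 2: "(u, v') \<in> adjoint_operator H ip T"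
  have H: "u \<in> H" "v \<in> H" "v' \<in> H" using 1 2 by (auto simp: adjoint_operator_iff)
  define z where "z = v - v'"
  have z: "z \<in> H" by (simp add: z_def H)
  have orth: "ip f z = 0" if "f \<in> Domain T" for f
  proof -
    obtain g where g: "(f, g) \<in> T" using \<open>f \<in> Domain T\<close> by auto
    then have "ip f v = ip g u" "ip f v' = ip g u" using 1 2 by (auto simp: adjoint_operator_iff)
    moreover have "f \<in> H" using g T by auto
    ultimately show ?thesis by (simp add: z_def ip_simps H)
  qed
  have "ip z z = 0"
  proof (rule ccontr)
    assume "ip z z \<noteq> 0"
    then have pos: "ip z z > 0" using ip_ge_zero[OF z] by simp
    then obtain f where f: "f \<in> Domain T" and less: "sqrt (ip (z - f) (z - f)) < sqrt (ip z z)"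
      using dense z unfolding dense_in_def by (metis real_sqrt_gt_zero)
    have fH: "f \<in> H" using f T by auto
    have "ip (z - f) (z - f) = ip z z + ip f f"
      using orth[OF f] by (simp add: ip_simps z fH ip_commute[of z f])
    then show False using less ip_ge_zero[OF fH] by simp
  qed
  then show "v = v'" using ip_eq_zeroD[OF z] by (simp add: z_def)
qed

lemma essentially_self_adjointI:
  assumes T: "symmetric_operator H ip T"
    and adj: "\<And>u v u' v'. (u, v) \<in> adjoint_operator H ip T \<Longrightarrow>
      (u', v') \<in> adjoint_operator H ip T \<Longrightarrow> ip v u' = ip u v'"
  shows "essentially_self_adjoint H ip T"
proof -
  let ?A = "adjoint_operator H ip T"
  have TH: "T \<subseteq> H \<times> H" and dense: "dense_in H ip (Domain T)"
    and sym: "\<And>f g f' g'. (f, g) \<in> T \<Longrightarrow> (f', g') \<in> T \<Longrightarrow> ip g f' = ip f g'"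
    using T unfolding symmetric_operator_def linear_operator_def by auto
  have AH: "?A \<subseteq> H \<times> H" unfolding adjoint_operator_def by auto
  have TA: "T \<subseteq> ?A"
    using TH sym by (auto simp: adjoint_operator_iff)
  have AA: "adjoint_operator H ip ?A = ?A"
  proof
    show "adjoint_operator H ip ?A \<subseteq> ?A" by (rule adjoint_operator_antimono[OF TA])
    show "?A \<subseteq> adjoint_operator H ip ?A"
      using AH adj by (auto simp: adjoint_operator_iff[of _ _ ?A])
  qed
  have "Domain ?A \<subseteq> H" using AH by auto
  then have "dense_in H ip (Domain ?A)"
    using dense Domain_mono[OF TA] unfolding dense_in_def by blast
  then have sa: "self_adjoint_operator H ip ?A"
    unfolding self_adjoint_operator_def linear_operator_def
    using AA AH subspace_adjoint_operator[OF TH] single_valued_adjoint_operator[OF TH dense] by simp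
  have "S = ?A" if S: "self_adjoint_operator H ip S" and TS: "T \<subseteq> S" for S
  proof -
    have SS: "adjoint_operator H ip S = S" using S unfolding self_adjoint_operator_def by simp
    have "S \<subseteq> ?A" using adjoint_operator_antimono[OF TS] SS by simp
    moreover from adjoint_operator_antimono[OF this] have "?A \<subseteq> S" using SS AA by simp
    ultimately show ?thesis by auto
  qed
  with sa TA T show ?thesis unfolding essentially_self_adjoint_def by blast
qed

text \<open>The range of \<open>T + \<mu>\<close> is dense and \<open>T + \<mu>\<close> is bounded below, so every element of the
  adjoint of \<open>T\<close> is a limit of elements of \<open>T\<close>.\<close>

theorem essentially_self_adjoint_semibounded:
  assumes T: "symmetric_operator H ip T"
    and low: "\<And>f g. (f, g) \<in> T \<Longrightarrow> ip f f \<le> ip (g + \<mu> *\<^sub>R f) f"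
    and ker: "\<And>u. u \<in> H \<Longrightarrow> (\<And>f g. (f, g) \<in> T \<Longrightarrow> ip (g + \<mu> *\<^sub>R f) u = 0) \<Longrightarrow> u = 0"
  shows "essentially_self_adjoint H ip T"
proof (rule essentially_self_adjointI[OF T])
  fix u v u' v'
  assume uv: "(u, v) \<in> adjoint_operator H ip T" and uv': "(u', v') \<in> adjoint_operator H ip T"
  have TH: "T \<subseteq> H \<times> H" and sub: "subspace T"
    and sym: "\<And>f g f' g'. (f, g) \<in> T \<Longrightarrow> (f', g') \<in> T \<Longrightarrow> ip g f' = ip f g'"
    using T unfolding symmetric_operator_def linear_operator_def by auto
  have TfH: "f \<in> H" and TgH: "g \<in> H" if "(f, g) \<in> T" for f g using that TH by auto
  have H: "u \<in> H" "v \<in> H" "u' \<in> H" "v' \<in> H"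
    using uv uv' by (auto simp: adjoint_operator_iff)
  have adj: "ip g u = ip f v" "ip g u' = ip f v'" if "(f, g) \<in> T" for f g
    using that uv uv' by (auto simp: adjoint_operator_iff)
  define A where "A = (\<lambda>p :: 'b \<times> 'b. snd p + \<mu> *\<^sub>R fst p)"
  have "linear A"
    unfolding A_def by (rule linearI) (auto simp: algebra_simps)
  then have "subspace (A ` T)" using sub by (rule linear_subspace_image)
  moreover have "A ` T \<subseteq> H" using TH by (auto simp: A_def)
  moreover have "z = 0" if "z \<in> H" "\<And>r. r \<in> A ` T \<Longrightarrow> ip r z = 0" for z
  proof (rule ker[OF that(1)])
    fix f g assume "(f, g) \<in> T"
    then show "ip (g + \<mu> *\<^sub>R f) z = 0" using that(2)[of "A (f, g)"] by (force simp: A_def)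
  qed
  moreover define w where "w = v + \<mu> *\<^sub>R u"
  have wH: "w \<in> H" by (simp add: w_def H)
  ultimately obtain Y where Y: "range Y \<subseteq> A ` T"
    and Ylim: "(\<lambda>n. ip (Y n - w) (Y n - w)) \<longlonglongrightarrow> 0"
    using trivial_orthogonal_imp_limit[of "A ` T" w] by blast
  have "\<exists>p. p \<in> T \<and> Y n = A p" for n using Y by blast
  then obtain P where P: "\<And>n. P n \<in> T" and YP: "\<And>n. Y n = A (P n)" by metis
  define X where "X = (\<lambda>n. fst (P n))"
  define Z where "Z = (\<lambda>n. snd (P n))"
  have XZ: "(X n, Z n) \<in> T" for n using P by (simp add: X_def Z_def)
  have Y_eq: "Y n = Z n + \<mu> *\<^sub>R X n" for n by (simp add: YP A_def X_def Z_def)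
  have XH: "X n \<in> H" and ZH: "Z n \<in> H" for n using XZ TfH TgH by blast+
  then have YH: "Y n \<in> H" for n by (simp add: Y_eq)
  have rX: "range X \<subseteq> H" and rY: "range Y \<subseteq> H" using XH YH by auto
  have bound: "ip f f \<le> ip (g + \<mu> *\<^sub>R f) (g + \<mu> *\<^sub>R f)" if fg: "(f, g) \<in> T" for f g
  proof -
    have "0 \<le> ip (g + \<mu> *\<^sub>R f - f) (g + \<mu> *\<^sub>R f - f)"
      by (rule ip_ge_zero) (simp add: TfH[OF fg] TgH[OF fg])
    also have "\<dots> = ip (g + \<mu> *\<^sub>R f) (g + \<mu> *\<^sub>R f) - 2 * ip (g + \<mu> *\<^sub>R f) f + ip f f"
      using TfH[OF fg] TgH[OF fg] by (simp add: ip_diff_left ip_diff_right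
          ip_commute[of f "g + \<mu> *\<^sub>R f"])
    finally show ?thesis using low[OF fg] by linarith
  qed
  have XY: "ip (X m - X n) (X m - X n) \<le> ip (Y m - Y n) (Y m - Y n)" for m n
  proof -
    have "(X m - X n, Z m - Z n) \<in> T"
      using subspace_diff[OF sub XZ[of m] XZ[of n]] by simp
    from bound[OF this] show ?thesis by (simp add: Y_eq algebra_simps)
  qed
  have "\<exists>N. \<forall>m\<ge>N. \<forall>n\<ge>N. ip (X m - X n) (X m - X n) < e" if e: "e > 0" for e
  proof -
    have "\<forall>\<^sub>F n in sequentially. ip (Y n - w) (Y n - w) < e / 4"
      using order_tendstoD(2)[OF Ylim, of "e / 4"] e by simp
    then obtain N where N: "\<And>n. n \<ge> N \<Longrightarrow> ip (Y n - w) (Y n - w) < e / 4"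
      by (auto simp: eventually_sequentially)
    have "ip (X m - X n) (X m - X n) < e" if "m \<ge> N" "n \<ge> N" for m n
    proof -
      have "0 \<le> ip (Y m + Y n - 2 *\<^sub>R w) (Y m + Y n - 2 *\<^sub>R w)"
        by (rule ip_ge_zero) (simp add: YH wH)
      moreover have "ip (Y m - Y n) (Y m - Y n) = 2 * ip (Y m - w) (Y m - w)
          + 2 * ip (Y n - w) (Y n - w) - ip (Y m + Y n - 2 *\<^sub>R w) (Y m + Y n - 2 *\<^sub>R w)"
        using YH wH by (simp add: ip_simps algebra_simps)
      ultimately show ?thesis using XY[of m n] N[OF that(1)] N[OF that(2)] by linarith
    qed
    then show ?thesis by blast
  qed
  then obtain x where x: "x \<in> H" and Xlim: "(\<lambda>n. ip (X n - x) (X n - x)) \<longlonglongrightarrow> 0"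
    using ip_complete[OF rX] by blast
  have "u - x = 0"
  proof (rule ker)
    fix f g assume fg: "(f, g) \<in> T"
    have f: "f \<in> H" and g: "g \<in> H" using fg TfH TgH by auto
    have "(\<lambda>n. ip (X n) (g + \<mu> *\<^sub>R f)) \<longlonglongrightarrow> ip x (g + \<mu> *\<^sub>R f)"
      by (rule ip_tendsto[OF rX x _ Xlim]) (simp add: f g)
    moreover have "ip (X n) (g + \<mu> *\<^sub>R f) = ip (Y n) f" for n
      using sym[OF XZ[of n] fg] f g XH ZH by (simp add: Y_eq ip_simps)
    moreover have "(\<lambda>n. ip (Y n) f) \<longlonglongrightarrow> ip w f"
      by (rule ip_tendsto[OF rY wH f Ylim])
    ultimately have "ip x (g + \<mu> *\<^sub>R f) = ip w f" using LIMSEQ_unique by simp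
    moreover have "ip (g + \<mu> *\<^sub>R f) u = ip w f"
      using adj(1)[OF fg] f g H by (simp add: w_def ip_simps ip_commute[of f])
    ultimately show "ip (g + \<mu> *\<^sub>R f) (u - x) = 0"
      using f g H x by (simp add: ip_diff_right ip_commute[of x])
  qed (simp add: H x)
  then have [simp]: "x = u" by simp
  have "(\<lambda>n. ip (Y n) u') \<longlonglongrightarrow> ip w u'"
    by (rule ip_tendsto[OF rY wH H(3) Ylim])
  moreover have "ip (Y n) u' = ip (X n) (v' + \<mu> *\<^sub>R u')" for n
    using adj(2)[OF XZ[of n]] XH ZH H by (simp add: Y_eq ip_simps)
  moreover have "(\<lambda>n. ip (X n) (v' + \<mu> *\<^sub>R u')) \<longlonglongrightarrow> ip u (v' + \<mu> *\<^sub>R u')"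
    using Xlim by (intro ip_tendsto[OF rX]) (simp_all add: H)
  ultimately have "ip w u' = ip u (v' + \<mu> *\<^sub>R u')" using LIMSEQ_unique by simp
  then show "ip v u' = ip u v'" using H by (simp add: w_def ip_simps)
qed

end


section \<open>The weighted space of square-summable functions\<close>

lemma l2_iff: "f \<in> l2 V \<omega>\<^sub>0 \<longleftrightarrow> f \<in> functions_on V \<and> (\<lambda>x. \<omega>\<^sub>0\<^sup>2 * f x * f x) summable_on V"
  by (simp add: l2_def power2_eq_square mult.assoc)

lemma l2_mult_summable:
  assumes "f \<in> l2 V \<omega>\<^sub>0" "g \<in> l2 V \<omega>\<^sub>0"
  shows "(\<lambda>x. \<omega>\<^sub>0\<^sup>2 * f x * g x) summable_on V"
proof -
  have "(\<lambda>x. \<omega>\<^sub>0\<^sup>2 * f x * f x + \<omega>\<^sub>0\<^sup>2 * g x * g x) summable_on V"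
    using assms by (intro summable_on_add) (auto simp: l2_iff)
  moreover have "norm (\<omega>\<^sub>0\<^sup>2 * f x * g x) \<le> \<omega>\<^sub>0\<^sup>2 * f x * f x + \<omega>\<^sub>0\<^sup>2 * g x * g x" for x
  proof -
    have "2 * \<bar>f x * g x\<bar> \<le> f x * f x + g x * g x"
      using sum_squares_bound[of "\<bar>f x\<bar>" "\<bar>g x\<bar>"] by (simp add: abs_mult power2_eq_square)
    then have "\<bar>f x * g x\<bar> \<le> f x * f x + g x * g x" by linarith
    from mult_left_mono[OF this, of "\<omega>\<^sub>0\<^sup>2"] show ?thesis
      by (simp add: abs_mult algebra_simps)
  qed
  ultimately have "(\<lambda>x. norm (\<omega>\<^sub>0\<^sup>2 * f x * g x)) summable_on V"
    by (rule summable_on_comparison_test) auto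
  then show ?thesis by (rule abs_summable_summable)
qed

lemma subspace_l2: "subspace (l2 V \<omega>\<^sub>0)"
proof (rule subspaceI)
  show "0 \<in> l2 V \<omega>\<^sub>0" by (simp add: l2_iff functions_on_def)
next
  fix f g assume fg: "f \<in> l2 V \<omega>\<^sub>0" "g \<in> l2 V \<omega>\<^sub>0"
  have "(\<lambda>x. (\<omega>\<^sub>0\<^sup>2 * f x * f x + \<omega>\<^sub>0\<^sup>2 * f x * g x) + (\<omega>\<^sub>0\<^sup>2 * g x * f x + \<omega>\<^sub>0\<^sup>2 * g x * g x)) summable_on V"
    using fg by (intro summable_on_add l2_mult_summable)
  then show "f + g \<in> l2 V \<omega>\<^sub>0"
    using fg by (simp add: l2_iff functions_on_def algebra_simps)
next
  fix r :: real and f assume f: "f \<in> l2 V \<omega>\<^sub>0"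
  have "(\<lambda>x. (r * r) * (\<omega>\<^sub>0\<^sup>2 * f x * f x)) summable_on V"
    using f by (intro summable_on_cmult_right l2_mult_summable)
  then show "r *\<^sub>R f \<in> l2 V \<omega>\<^sub>0"
    using f by (simp add: l2_iff functions_on_def scaleR_fun_def ac_simps)
qed

lemma l2_inner_self_ge:
  assumes "f \<in> l2 V \<omega>\<^sub>0" "finite F" "F \<subseteq> V"
  shows "(\<Sum>x\<in>F. \<omega>\<^sub>0\<^sup>2 * f x * f x) \<le> l2_inner V \<omega>\<^sub>0 f f"
  unfolding l2_inner_def
  by (rule finite_sum_le_infsum) (use assms in \<open>auto simp: l2_iff mult.assoc\<close>)

lemma l2_complete:
  assumes \<omega>: "\<omega>\<^sub>0 > 0" and X: "range X \<subseteq> l2 V \<omega>\<^sub>0"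
    and cau: "\<And>e. e > 0 \<Longrightarrow>
      \<exists>N. \<forall>m\<ge>N. \<forall>n\<ge>N. l2_inner V \<omega>\<^sub>0 (X m - X n) (X m - X n) < e"
  shows "\<exists>l\<in>l2 V \<omega>\<^sub>0. (\<lambda>n. l2_inner V \<omega>\<^sub>0 (X n - l) (X n - l)) \<longlonglongrightarrow> 0"
proof -
  have Xl2: "X n \<in> l2 V \<omega>\<^sub>0" for n using X by auto
  have diff: "X m - X n \<in> l2 V \<omega>\<^sub>0" for m n
    by (intro subspace_diff subspace_l2 Xl2)
  have "convergent (\<lambda>n. X n x)" for x
  proof (cases "x \<in> V")
    case True
    have "Cauchy (\<lambda>n. X n x)"
    proof (rule metric_CauchyI)
      fix e :: real assume e: "e > 0"
      then have "\<omega>\<^sub>0\<^sup>2 * e\<^sup>2 > 0" using \<omega> by simp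
      from cau[OF this] obtain N
        where N: "\<And>m n. m \<ge> N \<Longrightarrow> n \<ge> N \<Longrightarrow>
          l2_inner V \<omega>\<^sub>0 (X m - X n) (X m - X n) < \<omega>\<^sub>0\<^sup>2 * e\<^sup>2"
        by blast
      have "dist (X m x) (X n x) < e" if "m \<ge> N" "n \<ge> N" for m n
      proof -
        have "\<omega>\<^sub>0\<^sup>2 * (X m x - X n x)\<^sup>2 < \<omega>\<^sub>0\<^sup>2 * e\<^sup>2"
          using l2_inner_self_ge[OF diff[of m n], of "{x}"] N[OF that] True
          by (simp add: power2_eq_square mult.assoc)
        then have "(X m x - X n x)\<^sup>2 < e\<^sup>2" using \<omega> by simp
        then show ?thesis using e power2_less_imp_less[of "\<bar>X m x - X n x\<bar>" e]
          by (simp add: dist_real_def)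
      qed
      then show "\<exists>N. \<forall>m\<ge>N. \<forall>n\<ge>N. dist (X m x) (X n x) < e" by blast
    qed
    then show ?thesis by (rule Cauchy_convergent)
  next
    case False
    then have "X n x = 0" for n using Xl2[of n] by (simp add: l2_iff functions_on_def)
    then show ?thesis by (simp add: convergent_const)
  qed
  then obtain l where lim: "\<And>x. (\<lambda>n. X n x) \<longlonglongrightarrow> l x"
    unfolding convergent_def by metis
  have l0: "l x = 0" if "x \<notin> V" for x
  proof -
    have "X n x = 0" for n using Xl2[of n] that by (simp add: l2_iff functions_on_def)
    then show ?thesis using lim[of x] LIMSEQ_unique[OF _ tendsto_const] by simp
  qed
  have tail: "\<exists>N. \<forall>n\<ge>N. X n - l \<in> l2 V \<omega>\<^sub>0 \<and> l2_inner V \<omega>\<^sub>0 (X n - l) (X n - l) \<le> e"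
    if e: "e > 0" for e
  proof -
    obtain N where N: "\<And>m n. m \<ge> N \<Longrightarrow> n \<ge> N \<Longrightarrow> l2_inner V \<omega>\<^sub>0 (X m - X n) (X m - X n) < e"
      using cau[OF e] by blast
    have "X n - l \<in> l2 V \<omega>\<^sub>0 \<and> l2_inner V \<omega>\<^sub>0 (X n - l) (X n - l) \<le> e" if n: "n \<ge> N" for n
    proof -
      have fin: "(\<Sum>x\<in>F. \<omega>\<^sub>0\<^sup>2 * (X n - l) x * (X n - l) x) \<le> e" if F: "finite F" "F \<subseteq> V" for F
      proof (rule LIMSEQ_le_const2)
        show "(\<lambda>m. \<Sum>x\<in>F. \<omega>\<^sub>0\<^sup>2 * (X n - X m) x * (X n - X m) x)
            \<longlonglongrightarrow> (\<Sum>x\<in>F. \<omega>\<^sub>0\<^sup>2 * (X n - l) x * (X n - l) x)"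
          by (auto intro!: tendsto_intros lim)
        show "\<exists>N. \<forall>m\<ge>N. (\<Sum>x\<in>F. \<omega>\<^sub>0\<^sup>2 * (X n - X m) x * (X n - X m) x) \<le> e"
          using l2_inner_self_ge[OF diff F] N[OF n] by (meson less_imp_le order_trans)
      qed
      have "(\<lambda>x. \<omega>\<^sub>0\<^sup>2 * (X n - l) x * (X n - l) x) summable_on V"
        by (rule nonneg_bdd_above_summable_on)
           (use fin in \<open>auto intro!: bdd_aboveI[of _ e] simp: mult.assoc\<close>)
      moreover from this have "l2_inner V \<omega>\<^sub>0 (X n - l) (X n - l) \<le> e"
        unfolding l2_inner_def by (rule infsum_le_finite_sums) (use fin in auto)
      ultimately show ?thesis
        using Xl2[of n] l0 by (simp add: l2_iff functions_on_def)
    qed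
    then show ?thesis by blast
  qed
  obtain n where "X n - l \<in> l2 V \<omega>\<^sub>0" using tail[of 1] by auto
  then have l: "l \<in> l2 V \<omega>\<^sub>0" using subspace_diff[OF subspace_l2 Xl2[of n]] by fastforce
  have "(\<lambda>n. l2_inner V \<omega>\<^sub>0 (X n - l) (X n - l)) \<longlonglongrightarrow> 0"
  proof (rule LIMSEQ_I)
    fix e :: real assume "e > 0"
    then obtain N where N: "\<And>n. n \<ge> N \<Longrightarrow> l2_inner V \<omega>\<^sub>0 (X n - l) (X n - l) \<le> e / 2"
      using tail[of "e / 2"] by auto
    have "0 \<le> l2_inner V \<omega>\<^sub>0 (X n - l) (X n - l)" for n
      unfolding l2_inner_def by (rule infsum_nonneg) (simp add: mult.assoc)
    then have "norm (l2_inner V \<omega>\<^sub>0 (X n - l) (X n - l) - 0) < e" if "n \<ge> N" for n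
      using N[OF that] \<open>e > 0\<close> by (simp add: abs_of_nonneg)
    then show "\<exists>N. \<forall>n\<ge>N. norm (l2_inner V \<omega>\<^sub>0 (X n - l) (X n - l) - 0) < e" by blast
  qed
  with l show ?thesis by blast
qed

lemma real_hilbert_l2:
  assumes \<omega>: "\<omega>\<^sub>0 > 0"
  shows "real_hilbert (l2 V \<omega>\<^sub>0) (l2_inner V \<omega>\<^sub>0)"
proof
  show "subspace (l2 V \<omega>\<^sub>0)" by (rule subspace_l2)
next
  fix f g assume "f \<in> l2 V \<omega>\<^sub>0" "g \<in> l2 V \<omega>\<^sub>0"
  show "l2_inner V \<omega>\<^sub>0 f g = l2_inner V \<omega>\<^sub>0 g f"
    by (simp add: l2_inner_def ac_simps)
next
  fix f g h assume "f \<in> l2 V \<omega>\<^sub>0" "g \<in> l2 V \<omega>\<^sub>0" "h \<in> l2 V \<omega>\<^sub>0"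
  then have "l2_inner V \<omega>\<^sub>0 f h + l2_inner V \<omega>\<^sub>0 g h =
      (\<Sum>\<^sub>\<infinity>x\<in>V. \<omega>\<^sub>0\<^sup>2 * f x * h x + \<omega>\<^sub>0\<^sup>2 * g x * h x)"
    unfolding l2_inner_def by (intro infsum_add[symmetric] l2_mult_summable)
  then show "l2_inner V \<omega>\<^sub>0 (f + g) h = l2_inner V \<omega>\<^sub>0 f h + l2_inner V \<omega>\<^sub>0 g h"
    by (simp add: l2_inner_def algebra_simps)
next
  fix f h and r :: real assume "f \<in> l2 V \<omega>\<^sub>0" "h \<in> l2 V \<omega>\<^sub>0"
  have "l2_inner V \<omega>\<^sub>0 (r *\<^sub>R f) h = (\<Sum>\<^sub>\<infinity>x\<in>V. r * (\<omega>\<^sub>0\<^sup>2 * f x * h x))"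
    by (simp add: l2_inner_def scaleR_fun_def ac_simps)
  then show "l2_inner V \<omega>\<^sub>0 (r *\<^sub>R f) h = r * l2_inner V \<omega>\<^sub>0 f h"
    by (simp add: l2_inner_def infsum_cmult_right')
next
  fix f assume f: "f \<in> l2 V \<omega>\<^sub>0"
  show "0 \<le> l2_inner V \<omega>\<^sub>0 f f"
    unfolding l2_inner_def by (rule infsum_nonneg) (simp add: mult.assoc)
  assume 0: "l2_inner V \<omega>\<^sub>0 f f = 0"
  show "f = 0"
  proof
    fix x
    show "f x = 0 x"
    proof (cases "x \<in> V")
      case True
      then show ?thesis using l2_inner_self_ge[OF f, of "{x}"] 0 \<omega>
        by (auto simp: mult.assoc mult_le_0_iff)
    next
      case False
      then show ?thesis using f by (simp add: l2_iff functions_on_def)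
    qed
  qed
next
  fix X :: "nat \<Rightarrow> 'a \<Rightarrow> real"
  assume "range X \<subseteq> l2 V \<omega>\<^sub>0"
    and "\<And>e. e > 0 \<Longrightarrow> \<exists>N. \<forall>m\<ge>N. \<forall>n\<ge>N. l2_inner V \<omega>\<^sub>0 (X m - X n) (X m - X n) < e"
  then show "\<exists>l\<in>l2 V \<omega>\<^sub>0. (\<lambda>n. l2_inner V \<omega>\<^sub>0 (X n - l) (X n - l)) \<longlonglongrightarrow> 0"
    by (rule l2_complete[OF \<omega>])
qed

text \<open>A function in \<open>l\<^sup>2\<close> is at least \<open>u x\<^sub>0 > 0\<close> on a finite set only.\<close>

lemma l2_attains_pos_max:
  assumes \<omega>: "\<omega>\<^sub>0 > 0" and u: "u \<in> l2 V \<omega>\<^sub>0" and pos: "u x\<^sub>0 > 0"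
  obtains m where "m \<in> V" "u m > 0" "\<And>y. u y \<le> u m"
proof -
  define S where "S = {x. u x\<^sub>0 \<le> u x}"
  have SV: "S \<subseteq> V"
    using u pos by (force simp: S_def l2_iff functions_on_def)
  define b where "b = \<omega>\<^sub>0\<^sup>2 * u x\<^sub>0 * u x\<^sub>0"
  have b: "b > 0" using \<omega> pos by (simp add: b_def)
  have "finite S"
  proof (rule ccontr)
    assume "infinite S"
    obtain n :: nat where n: "l2_inner V \<omega>\<^sub>0 u u < real n * b"
      using ex_less_of_nat_mult[OF b] by blast
    obtain F where F: "finite F" "card F = n" "F \<subseteq> S"
      using infinite_arbitrarily_large[OF \<open>infinite S\<close>] by blast
    have "real n * b \<le> (\<Sum>x\<in>F. \<omega>\<^sub>0\<^sup>2 * u x * u x)"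
    proof -
      have "(\<Sum>x\<in>F. b) \<le> (\<Sum>x\<in>F. \<omega>\<^sub>0\<^sup>2 * u x * u x)"
        unfolding b_def mult.assoc using F pos
        by (intro sum_mono mult_left_mono mult_mono) (auto simp: S_def)
      then show ?thesis using F by simp
    qed
    also have "\<dots> \<le> l2_inner V \<omega>\<^sub>0 u u"
      using F SV by (intro l2_inner_self_ge[OF u]) auto
    finally show False using n by simp
  qed
  moreover have x0: "x\<^sub>0 \<in> S" by (simp add: S_def)
  ultimately obtain m where m: "m \<in> S" and max: "\<And>y. y \<in> S \<Longrightarrow> u y \<le> u m"
    using obtains_MAX[of S u] by (metis emptyE Max_ge finite_imageI imageI)
  have "u y \<le> u m" for y
    using max[of y] m by (cases "y \<in> S") (auto simp: S_def)
  then show ?thesis using that[of m] m SV pos by (force simp: S_def)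
qed

lemma l2_inner_finite_support:
  assumes "finite F" "F \<subseteq> V" "\<And>x. x \<in> V \<Longrightarrow> x \<notin> F \<Longrightarrow> f x * g x = 0"
  shows "l2_inner V \<omega>\<^sub>0 f g = (\<Sum>x\<in>F. \<omega>\<^sub>0\<^sup>2 * f x * g x)"
proof -
  have "l2_inner V \<omega>\<^sub>0 f g = (\<Sum>\<^sub>\<infinity>x\<in>F. \<omega>\<^sub>0\<^sup>2 * f x * g x)"
    unfolding l2_inner_def by (rule infsum_cong_neutral) (use assms in auto)
  then show ?thesis using \<open>finite F\<close> by simp
qed

lemma C0_subset_l2: "C0 V \<subseteq> l2 V \<omega>\<^sub>0"
proof
  fix f assume f: "f \<in> C0 V"
  have "(\<lambda>x. \<omega>\<^sub>0\<^sup>2 * f x * f x) summable_on V"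
    by (rule finite_nonzero_values_imp_summable_on)
       (use f in \<open>auto simp: C0_def elim!: rev_finite_subset\<close>)
  then show "f \<in> l2 V \<omega>\<^sub>0" using f by (simp add: l2_iff C0_def)
qed

lemma subspace_C0: "subspace (C0 V)"
proof (rule subspaceI)
  show "0 \<in> C0 V" by (simp add: C0_def functions_on_def)
next
  fix f g assume fg: "f \<in> C0 V" "g \<in> C0 V"
  have "finite {x \<in> V. (f + g) x \<noteq> 0}"
    by (rule finite_subset[of _ "{x \<in> V. f x \<noteq> 0} \<union> {x \<in> V. g x \<noteq> 0}"])
       (use fg in \<open>auto simp: C0_def\<close>)
  then show "f + g \<in> C0 V" using fg by (simp add: C0_def functions_on_def)
next
  fix r :: real and f assume f: "f \<in> C0 V"
  have "finite {x \<in> V. (r *\<^sub>R f) x \<noteq> 0}"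
    by (rule finite_subset[of _ "{x \<in> V. f x \<noteq> 0}"]) (use f in \<open>auto simp: C0_def scaleR_fun_def\<close>)
  then show "r *\<^sub>R f \<in> C0 V" using f by (simp add: C0_def functions_on_def scaleR_fun_def)
qed

lemma indicator_in_C0: "x \<in> V \<Longrightarrow> indicat_real {x} \<in> C0 V"
  by (auto simp: C0_def functions_on_def indicator_def intro: finite_subset[of _ "{x}"])

lemma l2_inner_indicator: "x \<in> V \<Longrightarrow> l2_inner V \<omega>\<^sub>0 (indicat_real {x}) u = \<omega>\<^sub>0\<^sup>2 * u x"
  by (subst l2_inner_finite_support[of "{x}"]) auto

lemma dense_in_C0:
  assumes "\<omega>\<^sub>0 > 0"
  shows "dense_in (l2 V \<omega>\<^sub>0) (l2_inner V \<omega>\<^sub>0) (C0 V)"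
proof (rule real_hilbert.dense_inI[OF real_hilbert_l2[OF assms] subspace_C0 C0_subset_l2])
  fix u assume u: "u \<in> l2 V \<omega>\<^sub>0" and orth: "\<And>r. r \<in> C0 V \<Longrightarrow> l2_inner V \<omega>\<^sub>0 r u = 0"
  have "u x = 0" for x
  proof (cases "x \<in> V")
    case True
    then show ?thesis
      using orth[OF indicator_in_C0[OF True]] assms by (simp add: l2_inner_indicator)
  qed (use u in \<open>simp add: l2_iff functions_on_def\<close>)
  then show "u = 0" by auto
qed

section \<open>The Schroedinger operator\<close>

locale weighted_graph =
  fixes V :: "'a set" and E :: "'a set set" and \<omega>\<^sub>0 :: real
    and c :: "'a set \<Rightarrow> real" and W :: "'a \<Rightarrow> real"
  assumes simple: "simple_graph V E" and locally_finite: "locally_finite_graph V E"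
    and weight_pos: "\<omega>\<^sub>0 > 0" and conductance_pos: "\<forall>e\<in>E. c e > 0"
begin

abbreviation "L \<equiv> schroedinger V E \<omega>\<^sub>0 c W"

definition edge_weight :: "'a \<Rightarrow> 'a \<Rightarrow> real"
  where "edge_weight x y = (if {x, y} \<in> E then c {x, y} else 0)"

definition supported_inside :: "'a set \<Rightarrow> ('a \<Rightarrow> real) \<Rightarrow> bool"
  where "supported_inside F f \<longleftrightarrow> finite F \<and> F \<subseteq> V \<and>
    (\<forall>x. f x \<noteq> 0 \<longrightarrow> x \<in> F \<and> neighbours E x \<subseteq> F)"

lemma edge_weight_nonneg: "0 \<le> edge_weight x y"
  using conductance_pos by (simp add: edge_weight_def less_imp_le)

lemma edge_weight_commute: "edge_weight x y = edge_weight y x"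
  by (simp add: edge_weight_def insert_commute)

lemma neighbours_subset: "neighbours E x \<subseteq> V"
  using simple unfolding simple_graph_def neighbours_def by (auto simp: doubleton_eq_iff dest!: bspec)

lemma neighbours_sym: "y \<in> neighbours E x \<longleftrightarrow> x \<in> neighbours E y"
  by (simp add: neighbours_def insert_commute)

lemma supported_inside_exists:
  assumes f: "f \<in> C0 V"
  obtains F where "supported_inside F f"
proof
  let ?S = "{x \<in> V. f x \<noteq> 0}"
  show "supported_inside (?S \<union> (\<Union>x\<in>?S. neighbours E x)) f"
    unfolding supported_inside_def
    using f locally_finite neighbours_subset
    by (fastforce simp: C0_def functions_on_def locally_finite_graph_def)
qed

lemma supported_inside_Un:
  assumes "supported_inside F f" "supported_inside G g"
  shows "supported_inside (F \<union> G) f" "supported_inside (F \<union> G) g"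
  using assms unfolding supported_inside_def by blast+

lemma L_supported_inside:
  assumes F: "supported_inside F f"
  shows "x \<in> F \<Longrightarrow> L f x = 1 / \<omega>\<^sub>0\<^sup>2 * (\<Sum>y\<in>F. edge_weight x y * (f x - f y)) + W x * f x"
    and "x \<notin> F \<Longrightarrow> L f x = 0"
proof -
  have fin: "finite F" and FV: "F \<subseteq> V" and supp: "\<And>x. x \<notin> F \<Longrightarrow> f x = 0"
    and nb: "\<And>x y. f x \<noteq> 0 \<Longrightarrow> y \<in> neighbours E x \<Longrightarrow> y \<in> F"
    using F unfolding supported_inside_def by blast+
  {
    assume x: "x \<in> F"
    then have xV: "x \<in> V" using FV by auto
    have "(\<Sum>y\<in>neighbours E x. c {x, y} * (f x - f y)) = (\<Sum>y\<in>F. edge_weight x y * (f x - f y))"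
    proof (rule sum.mono_neutral_cong)
      show "finite (neighbours E x)"
        using locally_finite xV by (simp add: locally_finite_graph_def)
      show "edge_weight x y * (f x - f y) = 0" if "y \<in> F - neighbours E x" for y
        using that by (simp add: edge_weight_def neighbours_def)
      show "c {x, y} * (f x - f y) = 0" if "y \<in> neighbours E x - F" for y
        using that nb[of x y] supp[of y] by auto
      show "c {x, y} * (f x - f y) = edge_weight x y * (f x - f y)"
        if "y \<in> neighbours E x \<inter> F" for y
        using that by (simp add: edge_weight_def neighbours_def)
    qed (rule fin)
    then show "L f x = 1 / \<omega>\<^sub>0\<^sup>2 * (\<Sum>y\<in>F. edge_weight x y * (f x - f y)) + W x * f x"
      using xV by (simp add: schroedinger_def)
  next
    assume x: "x \<notin> F"
    have "f y = 0" if "y \<in> neighbours E x" for y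
      using nb[of y x] that x neighbours_sym by blast
    then show "L f x = 0" using supp[OF x] by (simp add: schroedinger_def)
  }
qed

lemma L_in_C0:
  assumes "f \<in> C0 V"
  shows "L f \<in> C0 V"
proof -
  obtain F where F: "supported_inside F f" using supported_inside_exists assms .
  have "finite {x \<in> V. L f x \<noteq> 0}"
    by (rule finite_subset[of _ F]) (use F L_supported_inside(2) in \<open>auto simp: supported_inside_def\<close>)
  then show ?thesis by (simp add: C0_def functions_on_def schroedinger_def)
qed

lemma green_formula:
  assumes F: "supported_inside F f"
  shows "l2_inner V \<omega>\<^sub>0 (L f) u =
    (\<Sum>x\<in>F. \<Sum>y\<in>F. edge_weight x y * (f x - f y) * (u x - u y)) / 2
      + (\<Sum>x\<in>F. \<omega>\<^sub>0\<^sup>2 * W x * f x * u x)"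
proof -
  have fin: "finite F" and FV: "F \<subseteq> V" using F unfolding supported_inside_def by blast+
  define D where "D = (\<Sum>x\<in>F. \<Sum>y\<in>F. edge_weight x y * (f x - f y) * u x)"
  have "(\<Sum>x\<in>F. \<Sum>y\<in>F. edge_weight x y * (f x - f y) * u y)
      = (\<Sum>y\<in>F. \<Sum>x\<in>F. edge_weight x y * (f x - f y) * u y)"
    by (rule sum.swap)
  also have "\<dots> = - D"
    unfolding D_def sum_negf[symmetric]
    by (intro sum.cong refl) (subst edge_weight_commute, simp add: algebra_simps)
  finally have swap: "(\<Sum>x\<in>F. \<Sum>y\<in>F. edge_weight x y * (f x - f y) * u y) = - D" .
  have "(\<Sum>x\<in>F. \<Sum>y\<in>F. edge_weight x y * (f x - f y) * (u x - u y)) = 2 * D"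
    using swap by (simp add: right_diff_distrib sum_subtractf D_def)
  moreover have "l2_inner V \<omega>\<^sub>0 (L f) u = (\<Sum>x\<in>F. \<omega>\<^sub>0\<^sup>2 * L f x * u x)"
    by (rule l2_inner_finite_support[OF fin FV]) (simp add: L_supported_inside(2)[OF F])
  moreover have "\<dots> = (\<Sum>x\<in>F. (\<Sum>y\<in>F. edge_weight x y * (f x - f y) * u x) + \<omega>\<^sub>0\<^sup>2 * W x * f x * u x)"
  proof (rule sum.cong[OF refl])
    fix x assume "x \<in> F"
    then show "\<omega>\<^sub>0\<^sup>2 * L f x * u x =
        (\<Sum>y\<in>F. edge_weight x y * (f x - f y) * u x) + \<omega>\<^sub>0\<^sup>2 * W x * f x * u x"
      using weight_pos
      by (simp add: L_supported_inside(1)[OF F] distrib_left distrib_right sum_distrib_right)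
  qed
  ultimately show ?thesis by (simp add: sum.distrib D_def)
qed

lemma linear_operator_L: "linear_operator (l2 V \<omega>\<^sub>0) (operator_on (C0 V) L)"
proof -
  have "L 0 = 0" by (auto simp: schroedinger_def)
  moreover have "L (f + g) = L f + L g" for f g
    by (auto simp: schroedinger_def fun_eq_iff algebra_simps sum.distrib[symmetric]
        simp flip: add_divide_distrib)
  moreover have "L (r *\<^sub>R f) = r *\<^sub>R L f" for r f
    by (auto simp: schroedinger_def fun_eq_iff scaleR_fun_def algebra_simps sum_distrib_left)
  ultimately have "linear L" by (intro linearI)
  then have "linear (\<lambda>f. (f, L f))"
    by (intro linearI) (auto simp: linear_add linear_scale)
  then have "subspace (operator_on (C0 V) L)"
    unfolding operator_on_def by (intro linear_subspace_image subspace_C0)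
  moreover have "operator_on (C0 V) L \<subseteq> l2 V \<omega>\<^sub>0 \<times> l2 V \<omega>\<^sub>0"
    using C0_subset_l2 L_in_C0 by (fastforce simp: operator_on_def)
  ultimately show ?thesis
    by (auto simp: linear_operator_def operator_on_def single_valued_def)
qed

lemma symmetric_operator_L:
  "symmetric_operator (l2 V \<omega>\<^sub>0) (l2_inner V \<omega>\<^sub>0) (operator_on (C0 V) L)"
proof -
  have "l2_inner V \<omega>\<^sub>0 (L f) g = l2_inner V \<omega>\<^sub>0 f (L g)" if fg: "f \<in> C0 V" "g \<in> C0 V" for f g
  proof -
    obtain F G where "supported_inside F f" "supported_inside G g"
      using supported_inside_exists fg by metis
    note FG = supported_inside_Un[OF this]
    have "l2_inner V \<omega>\<^sub>0 (L f) g = l2_inner V \<omega>\<^sub>0 (L g) f"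
      unfolding green_formula[OF FG(1)] green_formula[OF FG(2)] by (simp add: ac_simps)
    then show ?thesis by (simp add: l2_inner_def ac_simps)
  qed
  moreover have "Domain (operator_on (C0 V) L) = C0 V"
    by (auto simp: operator_on_def)
  ultimately show ?thesis
    using linear_operator_L dense_in_C0[OF weight_pos]
    by (auto simp: symmetric_operator_def operator_on_def)
qed

lemma l2_inner_L_add_scaleR:
  assumes "f \<in> C0 V" "u \<in> l2 V \<omega>\<^sub>0"
  shows "l2_inner V \<omega>\<^sub>0 (L f + \<mu> *\<^sub>R f) u = l2_inner V \<omega>\<^sub>0 (L f) u + \<mu> * l2_inner V \<omega>\<^sub>0 f u"
proof -
  interpret real_hilbert "l2 V \<omega>\<^sub>0" "l2_inner V \<omega>\<^sub>0" by (rule real_hilbert_l2[OF weight_pos])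
  have "f \<in> l2 V \<omega>\<^sub>0" "L f \<in> l2 V \<omega>\<^sub>0" using assms(1) L_in_C0 C0_subset_l2 by blast+
  then show ?thesis using assms(2) by (simp add: ip_simps)
qed

lemma L_semibounded:
  assumes \<mu>: "\<And>x. x \<in> V \<Longrightarrow> 1 \<le> W x + \<mu>" and f: "f \<in> C0 V"
  shows "l2_inner V \<omega>\<^sub>0 f f \<le> l2_inner V \<omega>\<^sub>0 (L f + \<mu> *\<^sub>R f) f"
proof -
  obtain F where F: "supported_inside F f" using supported_inside_exists f .
  then have FV: "finite F" "F \<subseteq> V" and supp: "\<And>x. x \<notin> F \<Longrightarrow> f x = 0"
    unfolding supported_inside_def by blast+
  have ff: "l2_inner V \<omega>\<^sub>0 f f = (\<Sum>x\<in>F. \<omega>\<^sub>0\<^sup>2 * f x * f x)"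
    by (rule l2_inner_finite_support[OF FV]) (simp add: supp)
  have "l2_inner V \<omega>\<^sub>0 f f \<le> (\<Sum>x\<in>F. (W x + \<mu>) * (\<omega>\<^sub>0\<^sup>2 * f x * f x))"
    unfolding ff
  proof (rule sum_mono)
    fix x assume "x \<in> F"
    then have "1 \<le> W x + \<mu>" using \<mu> FV by auto
    then show "\<omega>\<^sub>0\<^sup>2 * f x * f x \<le> (W x + \<mu>) * (\<omega>\<^sub>0\<^sup>2 * f x * f x)"
      using mult_right_mono[of 1 "W x + \<mu>" "\<omega>\<^sub>0\<^sup>2 * f x * f x"] by (simp add: mult.assoc)
  qed
  also have "\<dots> = (\<Sum>x\<in>F. \<omega>\<^sub>0\<^sup>2 * W x * f x * f x) + \<mu> * l2_inner V \<omega>\<^sub>0 f f"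
    unfolding ff sum_distrib_left sum.distrib[symmetric] by (simp add: algebra_simps)
  also have "(\<Sum>x\<in>F. \<omega>\<^sub>0\<^sup>2 * W x * f x * f x) \<le> l2_inner V \<omega>\<^sub>0 (L f) f"
    unfolding green_formula[OF F]
    by (simp add: sum_nonneg edge_weight_nonneg mult.assoc)
  finally show ?thesis
    using l2_inner_L_add_scaleR[OF f subsetD[OF C0_subset_l2 f]] by simp
qed

text \<open>At a positive maximum \<open>m\<close> of \<open>u\<close>, testing with the indicator of \<open>m\<close> makes every
  term of the Green formula nonnegative.\<close>

lemma weak_solution_nonpos:
  assumes \<mu>: "\<And>x. x \<in> V \<Longrightarrow> 1 \<le> W x + \<mu>" and u: "u \<in> l2 V \<omega>\<^sub>0"
    and sol: "\<And>f. f \<in> C0 V \<Longrightarrow> l2_inner V \<omega>\<^sub>0 (L f + \<mu> *\<^sub>R f) u = 0"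
  shows "u x \<le> 0"
proof (rule ccontr)
  assume "\<not> u x \<le> 0"
  then have "u x > 0" by simp
  from l2_attains_pos_max[OF weight_pos u this] obtain m
    where m: "m \<in> V" and pos: "u m > 0" and max: "\<And>y. u y \<le> u m" by blast
  let ?d = "indicat_real {m}"
  have d: "?d \<in> C0 V" by (rule indicator_in_C0[OF m])
  obtain F where F: "supported_inside F ?d" using supported_inside_exists d .
  then have fin: "finite F" and mF: "m \<in> F" unfolding supported_inside_def by auto
  have "0 \<le> (?d x - ?d y) * (u x - u y)" for x y
    using max[of x] max[of y] by (auto simp: indicator_def)
  then have "0 \<le> (\<Sum>x\<in>F. \<Sum>y\<in>F. edge_weight x y * (?d x - ?d y) * (u x - u y))"
    by (intro sum_nonneg) (simp add: mult.assoc edge_weight_nonneg)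
  moreover have "(\<Sum>x\<in>F. \<omega>\<^sub>0\<^sup>2 * W x * ?d x * u x) = \<omega>\<^sub>0\<^sup>2 * W m * u m"
  proof -
    have "(\<Sum>x\<in>F. \<omega>\<^sub>0\<^sup>2 * W x * ?d x * u x) = (\<Sum>x\<in>F. if x = m then \<omega>\<^sub>0\<^sup>2 * W x * u x else 0)"
      by (intro sum.cong) (auto simp: indicator_def)
    then show ?thesis using fin mF by simp
  qed
  ultimately have "\<omega>\<^sub>0\<^sup>2 * W m * u m \<le> l2_inner V \<omega>\<^sub>0 (L ?d) u"
    unfolding green_formula[OF F] by simp
  then have "\<omega>\<^sub>0\<^sup>2 * u m * (W m + \<mu>) \<le> l2_inner V \<omega>\<^sub>0 (L ?d + \<mu> *\<^sub>R ?d) u"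
    unfolding l2_inner_L_add_scaleR[OF d u] l2_inner_indicator[OF m] by (simp add: algebra_simps)
  moreover have "0 < \<omega>\<^sub>0\<^sup>2 * u m * (W m + \<mu>)"
    using weight_pos pos \<mu>[OF m] by simp
  ultimately show False using sol[OF d] by simp
qed

lemma essentially_self_adjoint_L:
  assumes "bdd_below (W ` V)"
  shows "essentially_self_adjoint (l2 V \<omega>\<^sub>0) (l2_inner V \<omega>\<^sub>0) (operator_on (C0 V) L)"
proof -
  interpret real_hilbert "l2 V \<omega>\<^sub>0" "l2_inner V \<omega>\<^sub>0" by (rule real_hilbert_l2[OF weight_pos])
  obtain b where "\<And>x. x \<in> V \<Longrightarrow> b \<le> W x"
    using assms by (auto simp: bdd_below_def)
  then have \<mu>: "1 \<le> W x + (1 - b)" if "x \<in> V" for x using that by force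
  show ?thesis
  proof (rule essentially_self_adjoint_semibounded[OF symmetric_operator_L])
    fix f g assume "(f, g) \<in> operator_on (C0 V) L"
    then show "l2_inner V \<omega>\<^sub>0 f f \<le> l2_inner V \<omega>\<^sub>0 (g + (1 - b) *\<^sub>R f) f"
      using L_semibounded[OF \<mu>] by (auto simp: operator_on_def)
  next
    fix u
    assume u: "u \<in> l2 V \<omega>\<^sub>0" and
      sol: "\<And>f g. (f, g) \<in> operator_on (C0 V) L \<Longrightarrow> l2_inner V \<omega>\<^sub>0 (g + (1 - b) *\<^sub>R f) u = 0"
    have sol': "l2_inner V \<omega>\<^sub>0 (L f + (1 - b) *\<^sub>R f) u = 0" if "f \<in> C0 V" for f
      using sol that by (auto simp: operator_on_def)
    have neg: "(-1) *\<^sub>R u \<in> l2 V \<omega>\<^sub>0" using u by (rule carrier_closed)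
    have "l2_inner V \<omega>\<^sub>0 (L f + (1 - b) *\<^sub>R f) ((-1) *\<^sub>R u) = 0" if f: "f \<in> C0 V" for f
    proof -
      have "f \<in> l2 V \<omega>\<^sub>0" "L f \<in> l2 V \<omega>\<^sub>0" using f L_in_C0 C0_subset_l2 by blast+
      then show ?thesis by (subst ip_scaleR_right) (auto simp: u sol'[OF f])
    qed
    then have "((-1) *\<^sub>R u) x \<le> 0" for x by (intro weak_solution_nonpos[OF \<mu> neg])
    then have "u x = 0" for x
      using weak_solution_nonpos[OF \<mu> u sol', of x]
      by (simp add: scaleR_fun_def order_antisym)
    then show "u = 0" by auto
  qed
qed

end

theorem theorem3p2:
  fixes V :: "'a set" and E :: "'a set set"
    and W :: "'a \<Rightarrow> real" and c :: "'a set \<Rightarrow> real" and \<omega>\<^sub>0 :: real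
  assumes "simple_graph V E"
    and "infinite V"
    and "connected_graph V E"
    and "locally_finite_graph V E"
    and "bdd_below (W ` V)"
    and "\<omega>\<^sub>0 > 0"
    and "\<forall>e\<in>E. c e > 0"
  shows "essentially_self_adjoint (l2 V \<omega>\<^sub>0) (l2_inner V \<omega>\<^sub>0)
    (operator_on (C0 V) (schroedinger V E \<omega>\<^sub>0 c W))"
proof -
  interpret weighted_graph V E \<omega>\<^sub>0 c W using assms by unfold_locales
  show ?thesis by (rule essentially_self_adjoint_L[OF assms(5)])
qed

end
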